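(* Let the unconstrained bilevel program (UBLPP) $$\min_{x,y}F(x,y)\quad\text{s.t.}\quad y\in\arg\min_yf(x,y)$$ be simple at its local minimizer $(\bar x,\bar y)\in M$, i.e., Case I (Type 1) or Case II holds. Then there exist $\mu\ge0$ and $w\in\mathbb{R}^m$ such that $$\begin{aligned} 0&=\nabla_xF(\bar x,\bar y)+\mu\big(\nabla_xf(\bar x,\bar y)-\nabla_xf(\bar x,\bar y_2)\big)+\nabla^2_{yx}f(\bar x,\bar y)w,\\ 0&=\nabla_yF(\bar x,\bar y)+\nabla^2_{yy}f(\bar x,\bar y)w, \end{aligned}$$ where $\mu=0$ in Case I (so that the term with $\bar y_2$ is absent) and $\bar y_2$ is the distinct (other) minimizer of $f(\bar x,\cdot)$ in Case II.
   Context: Setting: $x\in\mathbb{R}$ (dimension $n=1$), $y\in\mathbb{R}^m$; $F:\mathbb{R}^{1+m}\to\mathbb{R}$ is continuously differentiable; $f:\mathbb{R}^{1+m}\to\mathbb{R}$ is three times continuously differentiable, and for all $(\hat x,c)\in\mathbb{R}\times\mathbb{R}$ the set $\{(x,y): |x-\hat x|\le1,\ f(x,y)\le c\}$ is compact. $S(x)$ denotes the set of global minimizers of $f(x,\cdot)$ and $M:=\{(x,y): y\in S(x)\}$. For $w\in\mathbb{R}^m$, $\nabla^2_{yx}f\,w:=\sum_{i=1}^m\frac{\partial^2f}{\partial x\partial y_i}w_i$. (UBLPP) is simple at $(\bar x,\bar y)\in M$ if one of the following occurs. Case I (Type 1): $S(\bar x)=\{\bar y\}$ and $(\bar x,\bar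 y)$ is of Type 1, which here means $\nabla_yf(\bar x,\bar y)=0$ and $\nabla^2_{yy}f(\bar x,\bar y)$ is nonsingular. Case II: $S(\bar x)=\{\bar y_1,\bar y_2\}$ with $\bar y_1=\bar y\neq\bar y_2$, both $\nabla^2_{yy}f(\bar x,\bar y_k)$, $k=1,2$, are nonsingular, and $\frac{d}{dx}[f(x,y_2(x))-f(x,y_1(x))]|_{x=\bar x}\neq0$, where $y_k(x)$ is the unique local minimizer of $f(x,\cdot)$ near $\bar y_k$ for $x$ near $\bar x$, $y_k(\bar x)=\bar y_k$. *)

theory Defs
  imports "HOL-Analysis.Analysis"
begin

text \<open>
  \<open>C_k k g\<close>: \<open>g\<close> is \<open>k\<close> times continuously differentiable on the whole space. As the dimension is
  finite, it suffices to ask this of the directional derivatives.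
\<close>

primrec C_k :: "nat \<Rightarrow> ('a::euclidean_space \<Rightarrow> real) \<Rightarrow> bool" where
  "C_k 0 g \<longleftrightarrow> continuous_on UNIV g"
| "C_k (Suc k) g \<longleftrightarrow>
     (\<forall>z. g differentiable (at z)) \<and> (\<forall>v. C_k k (\<lambda>z. frechet_derivative g (at z) v))"

definition partial_x :: "(real \<times> (real ^ 'm) \<Rightarrow> real) \<Rightarrow> real \<times> (real ^ 'm) \<Rightarrow> real" where
  "partial_x g = (\<lambda>(x, y). deriv (\<lambda>s. g (s, y)) x)"

definition partial_y :: "'m::finite \<Rightarrow> (real \<times> (real ^ 'm) \<Rightarrow> real) \<Rightarrow> real \<times> (real ^ 'm) \<Rightarrow> real" where
  "partial_y i g = (\<lambda>(x, y). deriv (\<lambda>t. g (x, y + t *\<^sub>R axis i 1)) 0)"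

definition grad_y :: "(real \<times> (real ^ 'm) \<Rightarrow> real) \<Rightarrow> real \<times> (real ^ 'm::finite) \<Rightarrow> real ^ 'm" where
  "grad_y g z = (\<chi> i. partial_y i g z)"

definition hess_yy :: "(real \<times> (real ^ 'm) \<Rightarrow> real) \<Rightarrow> real \<times> (real ^ 'm::finite) \<Rightarrow> real ^ 'm ^ 'm" where
  "hess_yy g z = (\<chi> i j. partial_y i (partial_y j g) z)"

definition hess_yx :: "(real \<times> (real ^ 'm) \<Rightarrow> real) \<Rightarrow> real \<times> (real ^ 'm::finite) \<Rightarrow> real ^ 'm \<Rightarrow> real" where
  "hess_yx g z w = (\<Sum>i\<in>UNIV. partial_x (partial_y i g) z * w $ i)"

definition local_minimizer_on :: "('a::topological_space \<Rightarrow> real) \<Rightarrow> 'a set \<Rightarrow> 'a \<Rightarrow> bool" where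
  "local_minimizer_on g A z \<longleftrightarrow> z \<in> A \<and> (\<forall>\<^sub>F u in at z within A. g z \<le> g u)"

definition S :: "(real \<times> (real ^ 'm) \<Rightarrow> real) \<Rightarrow> real \<Rightarrow> (real ^ 'm) set" where
  "S f x = {y. \<forall>y'. f (x, y) \<le> f (x, y')}"

definition M :: "(real \<times> (real ^ 'm) \<Rightarrow> real) \<Rightarrow> (real \<times> (real ^ 'm)) set" where
  "M f = {(x, y). y \<in> S f x}"

definition type_1 :: "(real \<times> (real ^ 'm::finite) \<Rightarrow> real) \<Rightarrow> real \<Rightarrow> real ^ 'm \<Rightarrow> bool" where
  "type_1 f xb yb \<longleftrightarrow> grad_y f (xb, yb) = 0 \<and> invertible (hess_yy f (xb, yb))"

text \<open>
  \<open>local_min_branch f xb yb \<eta>\<close>: \<open>\<eta> xb = yb\<close> and, for all \<open>x\<close> near \<open>xb\<close>, \<open>\<eta> x\<close> is the unique local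
  minimizer of \<open>f (x, \<cdot>)\<close> in a fixed ball around \<open>yb\<close>. Any two such \<open>\<eta>\<close> agree near \<open>xb\<close>: in the
  smaller of the two balls both are the only local minimizer.
\<close>

definition local_min_branch ::
  "(real \<times> (real ^ 'm::finite) \<Rightarrow> real) \<Rightarrow> real \<Rightarrow> real ^ 'm \<Rightarrow> (real \<Rightarrow> real ^ 'm) \<Rightarrow> bool" where
  "local_min_branch f xb yb \<eta> \<longleftrightarrow> \<eta> xb = yb \<and>
     (\<exists>\<epsilon>>0. \<forall>\<^sub>F x in nhds xb. \<eta> x \<in> ball yb \<epsilon> \<and>
        (\<forall>y\<in>ball yb \<epsilon>. local_minimizer_on (\<lambda>y. f (x, y)) UNIV y \<longleftrightarrow> y = \<eta> x))"

definition case_I :: "(real \<times> (real ^ 'm::finite) \<Rightarrow> real) \<Rightarrow> real \<Rightarrow> real ^ 'm \<Rightarrow> bool" where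
  "case_I f xb yb \<longleftrightarrow> S f xb = {yb} \<and> type_1 f xb yb"

definition case_II :: "(real \<times> (real ^ 'm::finite) \<Rightarrow> real) \<Rightarrow> real \<Rightarrow> real ^ 'm \<Rightarrow> real ^ 'm \<Rightarrow> bool" where
  "case_II f xb yb yb2 \<longleftrightarrow> S f xb = {yb, yb2} \<and> yb \<noteq> yb2 \<and>
     invertible (hess_yy f (xb, yb)) \<and> invertible (hess_yy f (xb, yb2)) \<and>
     (\<exists>\<eta>1 \<eta>2 D. local_min_branch f xb yb \<eta>1 \<and> local_min_branch f xb yb2 \<eta>2 \<and>
        ((\<lambda>x. f (x, \<eta>2 x) - f (x, \<eta>1 x)) has_real_derivative D) (at xb) \<and> D \<noteq> 0)"

definition simple_at :: "(real \<times> (real ^ 'm::finite) \<Rightarrow> real) \<Rightarrow> real \<Rightarrow> real ^ 'm \<Rightarrow> bool" where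
  "simple_at f xb yb \<longleftrightarrow> (xb, yb) \<in> M f \<and> (case_I f xb yb \<or> (\<exists>yb2. case_II f xb yb yb2))"

end

theory Submission imports Defs begin

text \<open>
  Choose \<open>y x \<in> S f x\<close> arbitrarily. On a side of \<open>xb\<close> where \<open>S f x\<close> shrinks to \<open>{yb}\<close>, the choice
  tends to \<open>yb\<close>, and as it solves \<open>grad_y f (x, y x) = 0\<close> with an invertible Jacobian at \<open>(xb, yb)\<close>,
  it has a one-sided derivative at \<open>xb\<close>. Local minimality of \<open>(xb, yb)\<close> then gives the sign of the
  one-sided derivative \<open>A\<close> of \<open>x \<mapsto> F (x, y x)\<close>, and \<open>w\<close> is the adjoint solution that expresses \<open>A\<close>
  as \<open>\<nabla>\<^sub>x F + \<nabla>\<^sup>2\<^sub>y\<^sub>x f w\<close>.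
  In Case I both sides of \<open>xb\<close> qualify, so \<open>A = 0\<close>. In Case II, by the envelope theorem, the gap of
  the two branch values has the derivative \<open>D = \<nabla>\<^sub>x f (xb, yb2) - \<nabla>\<^sub>x f (xb, yb) \<noteq> 0\<close>; only the side
  \<open>D * (x - xb) > 0\<close>, on which the branch of \<open>yb2\<close> is not optimal, qualifies. This gives
  \<open>D * A \<ge> 0\<close>, and \<open>\<mu> = A / D\<close>.
\<close>

section \<open>Smoothness classes and partial derivatives\<close>

lemma C_k_Suc_differentiable: "C_k (Suc n) g \<Longrightarrow> g differentiable (at z)"
  by simp

lemma C_k_Suc_continuous: "C_k (Suc n) g \<Longrightarrow> continuous_on UNIV g"
  by (simp add: continuous_at_imp_continuous_on differentiable_imp_continuous_within)

lemma C_k_Suc_imp_C_k: "C_k (Suc n) g \<Longrightarrow> C_k n g"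
proof (induction n arbitrary: g)
  case 0
  then show ?case using C_k_Suc_continuous[of 0 g] by simp
next
  case (Suc n)
  then show ?case by (metis C_k.simps(2))
qed

lemma partial_x_eq_frechet:
  fixes g :: "real \<times> (real ^ 'm::finite) \<Rightarrow> real"
  assumes "(g has_derivative g') (at z)"
  shows "partial_x g z = g' (1, 0)"
proof -
  obtain x y where z: "z = (x, y)" by (cases z)
  interpret g': bounded_linear g' using assms by (rule has_derivative_bounded_linear)
  have "((\<lambda>s. g (s, y)) has_derivative (\<lambda>h. g' (h, 0))) (at x)"
    by (rule has_derivative_compose[where f = "\<lambda>s. (s, y)" and g = g and g' = g'])
       (use assms z in \<open>auto intro!: derivative_eq_intros\<close>)
  moreover have "(\<lambda>h. g' (h, 0)) = (*) (g' (1, 0))"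
  proof
    show "g' (h, 0) = g' (1, 0) * h" for h
      using g'.scaleR[of h "(1, 0)"] by (simp add: mult.commute)
  qed
  ultimately have "((\<lambda>s. g (s, y)) has_real_derivative g' (1, 0)) (at x)"
    by (simp add: has_field_derivative_def)
  then show ?thesis by (simp add: partial_x_def z DERIV_imp_deriv)
qed

lemma partial_y_eq_frechet:
  fixes g :: "real \<times> (real ^ 'm::finite) \<Rightarrow> real"
  assumes "(g has_derivative g') (at z)"
  shows "partial_y i g z = g' (0, axis i 1)"
proof -
  obtain x y where z: "z = (x, y)" by (cases z)
  interpret g': bounded_linear g' using assms by (rule has_derivative_bounded_linear)
  have "((\<lambda>t. g (x, y + t *\<^sub>R axis i 1)) has_derivative (\<lambda>h. g' (0, h *\<^sub>R axis i 1))) (at 0)"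
    by (rule has_derivative_compose[where f = "\<lambda>t. (x, y + t *\<^sub>R axis i 1)" and g = g and g' = g'])
       (use assms z in \<open>auto intro!: derivative_eq_intros\<close>)
  moreover have "(\<lambda>h. g' (0, h *\<^sub>R axis i 1)) = (*) (g' (0, axis i 1))"
  proof
    show "g' (0, h *\<^sub>R axis i 1) = g' (0, axis i 1) * h" for h
      using g'.scaleR[of h "(0, axis i 1)"] by (simp add: mult.commute)
  qed
  ultimately have "((\<lambda>t. g (x, y + t *\<^sub>R axis i 1)) has_real_derivative g' (0, axis i 1)) (at 0)"
    by (simp add: has_field_derivative_def)
  then show ?thesis by (simp add: partial_y_def z DERIV_imp_deriv)
qed

text \<open>Links total derivatives to the coordinatewise definitions: by linearity the derivative
  is determined by its values on \<open>(1, 0)\<close> and on the vectors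
  \<open>(0, axis i 1)\<close>.\<close>

lemma has_derivative_partials:
  fixes g :: "real \<times> (real ^ 'm::finite) \<Rightarrow> real"
  assumes "g differentiable (at z)"
  shows "(g has_derivative (\<lambda>d. fst d * partial_x g z + grad_y g z \<bullet> snd d)) (at z)"
proof -
  obtain g' where g': "(g has_derivative g') (at z)"
    using assms by (auto simp: differentiable_def)
  interpret g': bounded_linear g' using g' by (rule has_derivative_bounded_linear)
  have "g' d = fst d * partial_x g z + grad_y g z \<bullet> snd d" for d
  proof -
    have sum: "snd d = (\<Sum>i\<in>UNIV. (snd d $ i) *\<^sub>R axis i 1)"
      by (simp add: vec_eq_iff axis_def if_distrib cong: if_cong)
    have "g' (0, snd d) = (\<Sum>i\<in>UNIV. (snd d $ i) * g' (0, axis i 1))"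
    proof -
      have "(0, snd d) = (\<Sum>i\<in>UNIV. (snd d $ i) *\<^sub>R (0::real, axis i (1::real)))"
        using sum by (simp add: prod_eq_iff fst_sum snd_sum)
      then show ?thesis by (simp add: g'.sum g'.scaleR del: scaleR_Pair)
    qed
    also have "\<dots> = grad_y g z \<bullet> snd d"
      by (simp add: inner_vec_def grad_y_def partial_y_eq_frechet[OF g'] mult.commute)
    finally have "g' (0, snd d) = grad_y g z \<bullet> snd d" .
    moreover have "g' d = fst d * g' (1, 0) + g' (0, snd d)"
      using g'.add[of "fst d *\<^sub>R (1, 0)" "(0, snd d)"] g'.scaleR[of "fst d" "(1, 0)"] by simp
    ultimately show ?thesis by (simp add: partial_x_eq_frechet[OF g'])
  qed
  then have "g' = (\<lambda>d. fst d * partial_x g z + grad_y g z \<bullet> snd d)" by auto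
  with g' show ?thesis by simp
qed

lemma C_k_partial_y:
  fixes g :: "real \<times> (real ^ 'm::finite) \<Rightarrow> real"
  assumes "C_k (Suc n) g"
  shows "C_k n (partial_y i g)"
proof -
  have "partial_y i g = (\<lambda>z. frechet_derivative g (at z) (0, axis i 1))"
    using assms frechet_derivative_works by (intro ext partial_y_eq_frechet) auto
  with assms show ?thesis by simp
qed

text \<open>The transpose of the Hessian appears because row \<open>i\<close> of \<^const>\<open>hess_yy\<close> collects the outer
  derivatives in direction \<open>i\<close>.\<close>

lemma grad_y_has_derivative:
  fixes f :: "real \<times> (real ^ 'm::finite) \<Rightarrow> real"
  assumes "C_k 2 f"
  shows "(grad_y f has_derivative
     (\<lambda>d. fst d *\<^sub>R (\<chi> i. partial_x (partial_y i f) z) + transpose (hess_yy f z) *v snd d)) (at z)"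
proof -
  have "(partial_y i f has_derivative
      (\<lambda>d. fst d * partial_x (partial_y i f) z + grad_y (partial_y i f) z \<bullet> snd d)) (at z)" for i
  proof (rule has_derivative_partials)
    have "C_k 1 (partial_y i f)" using C_k_partial_y[of 1 f i] assms by (simp only: Suc_1)
    then show "partial_y i f differentiable (at z)"
      using C_k_Suc_differentiable[of 0] by (simp only: One_nat_def)
  qed
  then have "((\<lambda>z. partial_y i f z) has_derivative
      (\<lambda>d. (fst d *\<^sub>R (\<chi> i. partial_x (partial_y i f) z)
            + transpose (hess_yy f z) *v snd d) $ i)) (at z)" for i
    by (simp add: matrix_vector_mult_def transpose_def hess_yy_def grad_y_def inner_vec_def)
  then show ?thesis
    by (subst has_derivative_componentwise_within)
       (auto simp: Basis_vec_def inner_axis grad_y_def)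
qed

lemma local_minimizer_grad_y_zero:
  fixes f :: "real \<times> (real ^ 'm::finite) \<Rightarrow> real"
  assumes "f differentiable (at (x, y))" and "local_minimizer_on (\<lambda>y. f (x, y)) UNIV y"
  shows "grad_y f (x, y) = 0"
proof -
  have "((\<lambda>y. f (x, y)) has_derivative
      (\<lambda>k. (\<lambda>d. fst d * partial_x f (x, y) + grad_y f (x, y) \<bullet> snd d) (0, k))) (at y)"
    by (rule has_derivative_compose[where f = "\<lambda>y. (x, y)" and g = f])
       (use has_derivative_partials[OF assms(1)] in \<open>auto intro!: derivative_eq_intros\<close>)
  then have "(\<lambda>k. grad_y f (x, y) \<bullet> k) = (\<lambda>k. 0)"
    using assms(2)
    by (intro has_derivative_local_min[of "\<lambda>y. f (x, y)" _ y]) (auto simp: local_minimizer_on_def)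
  then show ?thesis by (metis inner_eq_zero_iff)
qed

lemma S_imp_local_minimizer: "y \<in> S f x \<Longrightarrow> local_minimizer_on (\<lambda>y. f (x, y)) UNIV y"
  by (simp add: S_def local_minimizer_on_def)

section \<open>Derivatives of root curves at the base point\<close>

text \<open>Pointwise substitute for the implicit function theorem: the root curve is given, so only its
  differentiability at the base point has to be shown, and an injective partial derivative suffices.\<close>

lemma root_curve_has_derivative:
  fixes G :: "real \<times> 'a::euclidean_space \<Rightarrow> 'b::euclidean_space"
  assumes G: "(G has_derivative G') (at (x0, y x0))"
    and inj: "inj (\<lambda>k. G' (0, k))"
    and v: "G' (1, v) = 0"
    and lim: "(y \<longlongrightarrow> y x0) (at x0 within T)"
    and root: "\<forall>\<^sub>F x in at x0 within T. G (x, y x) = 0"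
    and root0: "G (x0, y x0) = 0"
  shows "(y has_derivative (\<lambda>h. h *\<^sub>R v)) (at x0 within T)"
proof -
  interpret G': bounded_linear G' using G by (rule has_derivative_bounded_linear)
  have "linear (\<lambda>k. G' (0, k))"
  proof (rule linearI)
    fix k l :: 'a and r :: real
    show "G' (0, k + l) = G' (0, k) + G' (0, l)" using G'.add[of "(0, k)" "(0, l)"] by simp
    show "G' (0, r *\<^sub>R k) = r *\<^sub>R G' (0, k)" using G'.scaleR[of r "(0, k)"] by simp
  qed
  \<comment> \<open>In finite dimension an injective linear map is bounded below; \<open>B\<close>
    later turns smallness of \<open>G' (0, u)\<close> into smallness of \<open>u\<close>.\<close>
  then obtain B where B: "B > 0" "\<And>k. B * norm k \<le> norm (G' (0, k))"
    using inj linear_inj_bounded_below_pos[of "\<lambda>k. G' (0, k)"] by blast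
  have key: "\<forall>\<^sub>F x in at x0 within T. norm (y x - y x0 - (x - x0) *\<^sub>R v) \<le> c * norm (x - x0)"
    if c: "c > 0" for c
  proof -
    \<comment> \<open>The first entry allows \<open>e * norm u\<close> to be absorbed into
      \<open>B * norm u\<close>; the second bounds the remaining error by \<open>c * B / 2\<close>
      per unit of \<open>\<bar>h\<bar>\<close>, where \<open>1 + norm v\<close> bounds the norm of
      \<open>(1, v)\<close>.\<close>
    define e where "e = min (B / 2) (c * B / (2 * (1 + norm v)))"
    have nv: "1 + norm v > 0" by (simp add: add_pos_nonneg)
    have e: "e > 0" "e \<le> B / 2" "e * (1 + norm v) \<le> c * B / 2"
    proof -
      show "e > 0" using B c nv by (simp add: e_def)
      show "e \<le> B / 2" unfolding e_def by (rule min.cobounded1)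
      have "e * (1 + norm v) \<le> c * B / (2 * (1 + norm v)) * (1 + norm v)"
        using nv by (intro mult_right_mono) (auto simp: e_def)
      also have "\<dots> = c * B / 2" using nv by (simp add: field_simps)
      finally show "e * (1 + norm v) \<le> c * B / 2" .
    qed
    obtain d where d: "d > 0" and
      Gd: "\<And>z. norm (z - (x0, y x0)) < d \<Longrightarrow>
        norm (G z - G (x0, y x0) - G' (z - (x0, y x0))) \<le> e * norm (z - (x0, y x0))"
      using G e(1) by (auto simp: has_derivative_at_alt)
    have "((\<lambda>x. (x, y x)) \<longlongrightarrow> (x0, y x0)) (at x0 within T)"
      by (intro tendsto_intros lim)
    then have "\<forall>\<^sub>F x in at x0 within T. norm ((x, y x) - (x0, y x0)) < d"
      using d tendstoD dist_norm by (metis (mono_tags, lifting) eventually_mono)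
    with root show ?thesis
    proof eventually_elim
      case (elim x)
      \<comment> \<open>\<open>u\<close> is the deviation from the candidate tangent. As
        \<open>G' (1, v) = 0\<close> and \<open>G\<close> vanishes at both points, the linearization
        error reduces to \<open>G' (0, u)\<close>.\<close>
      define h u where "h = x - x0" and "u = y x - y x0 - h *\<^sub>R v"
      have z: "(x, y x) - (x0, y x0) = h *\<^sub>R (1, v) + (0, u)" by (simp add: h_def u_def)
      have "G' ((x, y x) - (x0, y x0)) = G' (0, u)"
        unfolding z G'.add G'.scaleR v by simp
      with Gd[OF elim(2)] elim(1) root0
      have "norm (G' (0, u)) \<le> e * norm ((x, y x) - (x0, y x0))" by simp
      also have "\<dots> \<le> e * (\<bar>h\<bar> * (1 + norm v) + norm u)"
      proof -
        have "norm (h *\<^sub>R (1::real, v) + (0, u)) \<le> \<bar>h\<bar> * norm (1::real, v) + norm u"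
          using norm_triangle_ineq[of "h *\<^sub>R (1::real, v)" "(0, u)"]
          by (simp add: norm_Pair del: scaleR_Pair)
        moreover have "norm (1::real, v) \<le> 1 + norm v"
          using norm_Pair_le[of "1::real" v] by simp
        ultimately have "norm (h *\<^sub>R (1::real, v) + (0, u)) \<le> \<bar>h\<bar> * (1 + norm v) + norm u"
          by (smt (verit) mult_left_mono abs_ge_zero)
        then show ?thesis unfolding z using e(1) by (intro mult_left_mono) auto
      qed
      also have "\<dots> = \<bar>h\<bar> * (e * (1 + norm v)) + e * norm u" by (simp add: algebra_simps)
      also have "\<dots> \<le> \<bar>h\<bar> * (c * B / 2) + B / 2 * norm u"
        using e by (intro add_mono mult_left_mono mult_right_mono) auto
      \<comment> \<open>Half of \<open>B * norm u\<close> moves to the left, which leaves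
        \<open>norm u \<le> c * \<bar>h\<bar>\<close>.\<close>
      finally have "B * norm u \<le> \<bar>h\<bar> * (c * B / 2) + B / 2 * norm u"
        using B(2)[of u] by linarith
      then have "B * norm u \<le> B * (c * \<bar>h\<bar>)" by (simp add: field_simps)
      then have "norm u \<le> c * \<bar>h\<bar>" using B(1) by simp
      then show ?case by (simp add: u_def h_def)
    qed
  qed
  show ?thesis unfolding has_derivative_within_alt2
    using key by (auto intro: bounded_linear_scaleR_left)
qed

text \<open>Implicit differentiation of \<open>grad_y f (x, y x) = 0\<close>: \<open>v\<close>
  solves the linearized equation. The set \<open>T\<close> admits one-sided derivatives.\<close>

lemma critical_curve_has_derivative:
  fixes f :: "real \<times> (real ^ 'm::finite) \<Rightarrow> real"
  assumes f: "C_k 2 f" and inv: "invertible (hess_yy f (x0, y x0))"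
    and v: "transpose (hess_yy f (x0, y x0)) *v v = - (\<chi> i. partial_x (partial_y i f) (x0, y x0))"
    and lim: "(y \<longlongrightarrow> y x0) (at x0 within T)"
    and crit: "\<forall>\<^sub>F x in at x0 within T. grad_y f (x, y x) = 0"
    and crit0: "grad_y f (x0, y x0) = 0"
  shows "(y has_derivative (\<lambda>h. h *\<^sub>R v)) (at x0 within T)"
proof (rule root_curve_has_derivative[OF grad_y_has_derivative[OF f] _ _ lim crit crit0])
  have "inj ((*v) (transpose (hess_yy f (x0, y x0))))"
    by (intro inj_matrix_vector_mult transpose_invertible inv)
  then show "inj (\<lambda>k. fst (0::real, k) *\<^sub>R (\<chi> i. partial_x (partial_y i f) (x0, y x0)) +
      transpose (hess_yy f (x0, y x0)) *v snd (0::real, k))"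
    unfolding fst_conv snd_conv scaleR_zero_left add_0 .
qed (use v in simp)

lemma invertible_solve:
  fixes A :: "real ^ 'm ^ 'm::finite"
  assumes "invertible A"
  obtains v where "A *v v = b"
  by (metis assms invertible_def matrix_vector_mul_assoc matrix_vector_mul_lid)

lemma has_derivative_along_curve:
  fixes g :: "real \<times> (real ^ 'm::finite) \<Rightarrow> real"
  assumes g: "g differentiable (at (x0, y x0))"
    and y: "(y has_derivative (\<lambda>h. h *\<^sub>R v)) (at x0 within T)"
  shows "((\<lambda>x. g (x, y x)) has_real_derivative
     partial_x g (x0, y x0) + grad_y g (x0, y x0) \<bullet> v) (at x0 within T)"
proof -
  have "((\<lambda>x. (x, y x)) has_derivative (\<lambda>h. (h, h *\<^sub>R v))) (at x0 within T)"
    by (intro has_derivative_Pair y has_derivative_ident)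
  from has_derivative_compose[OF this has_derivative_partials[OF g]]
  show ?thesis
    unfolding has_field_derivative_def
    by (rule has_derivative_eq_rhs) (auto simp: algebra_simps)
qed

section \<open>Existence and upper semicontinuity of minimizers\<close>

text \<open>Weierstrass on the slice over \<open>x\<close> of the sublevel set at height
  \<open>f (x, 0)\<close>; every \<open>y'\<close> outside that slice is worse than
  \<open>0\<close>.\<close>

lemma S_nonempty:
  fixes f :: "real \<times> (real ^ 'm::finite) \<Rightarrow> real"
  assumes cont: "continuous_on UNIV f"
    and comp: "\<And>xh c. compact {(x, y). \<bar>x - xh\<bar> \<le> 1 \<and> f (x, y) \<le> c}"
  shows "S f x \<noteq> {}"
proof -
  define K where "K = {(x', y). \<bar>x' - x\<bar> \<le> 1 \<and> f (x', y) \<le> f (x, 0)} \<inter> {x} \<times> UNIV"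
  have "compact K" unfolding K_def
    using closed_Times[OF closed_singleton[of x] closed_UNIV] by (rule compact_Int_closed[OF comp])
  moreover have "(x, 0) \<in> K" by (simp add: K_def)
  ultimately obtain z where z: "z \<in> K" "\<forall>u\<in>K. f z \<le> f u"
    using continuous_attains_inf[OF \<open>compact K\<close> _ continuous_on_subset[OF cont subset_UNIV]] by blast
  then obtain y where y: "z = (x, y)" by (auto simp: K_def)
  have "f (x, y) \<le> f (x, y')" for y'
  proof (cases "f (x, y') \<le> f (x, 0)")
    case True
    then have "(x, y') \<in> K" by (simp add: K_def)
    then show ?thesis using z y by blast
  next
    case False
    then show ?thesis using z(1) y by (simp add: K_def)
  qed
  then show ?thesis by (auto simp: S_def)
qed

text \<open>Otherwise there are minimizers outside \<open>N\<close> for parameters tending to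
  \<open>x0\<close>. They lie in one compact sublevel set, and a limit of a subsequence is again a
  minimizer by continuity, yet outside \<open>N\<close> because the complement of \<open>N\<close>
  is closed.\<close>

lemma S_upper_semicontinuous:
  fixes f :: "real \<times> (real ^ 'm::finite) \<Rightarrow> real"
  assumes cont: "continuous_on UNIV f"
    and comp: "\<And>xh c. compact {(x, y). \<bar>x - xh\<bar> \<le> 1 \<and> f (x, y) \<le> c}"
    and N: "open N" "S f x0 \<subseteq> N"
  shows "\<forall>\<^sub>F x in nhds x0. S f x \<subseteq> N"
proof (rule ccontr)
  assume "\<not> ?thesis"
  then have freq: "\<exists>x. dist x x0 < d \<and> \<not> S f x \<subseteq> N" if "d > 0" for d
    using that by (auto simp: eventually_nhds_metric)
  have contx: "isCont (\<lambda>x. f (x, y')) x" for x y'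
  proof -
    have "continuous_on UNIV (\<lambda>x. f (x, y'))"
      by (intro continuous_on_compose2[OF cont] continuous_intros) auto
    then show ?thesis by (simp add: continuous_on_eq_continuous_at)
  qed
  have "\<forall>\<^sub>F x in nhds x0. f (x, 0) < f (x0, 0) + 1"
    using contx[where x = x0 and y' = 0]
    by (intro order_tendstoD(2)[OF tendsto_at_iff_tendsto_nhds[THEN iffD1]]) (auto simp: isCont_def)
  then obtain r where r: "r > 0" "\<And>x. dist x x0 < r \<Longrightarrow> f (x, 0) < f (x0, 0) + 1"
    by (auto simp: eventually_nhds_metric)
  \<comment> \<open>\<open>r\<close> controls the competitor value \<open>f (x, 0)\<close>,
    \<open>1\<close> keeps the points in the compact strip, and \<open>inverse (Suc n)\<close>
    forces convergence.\<close>
  define X where "X n = (SOME x. dist x x0 < min (min r 1) (inverse (Suc n)) \<and> \<not> S f x \<subseteq> N)" for n :: nat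
  have X: "dist (X n) x0 < min (min r 1) (inverse (Suc n)) \<and> \<not> S f (X n) \<subseteq> N" for n
    unfolding X_def by (rule someI_ex, rule freq) (use r in auto)
  then have "\<forall>n. \<exists>y. y \<in> S f (X n) \<and> y \<notin> N" by blast
  then obtain Y where Y: "\<And>n. Y n \<in> S f (X n)" "\<And>n. Y n \<notin> N" by metis
  have Xlim: "X \<longlonglongrightarrow> x0"
  proof (rule metric_LIMSEQ_I)
    fix e :: real assume "e > 0"
    then obtain k where "inverse (Suc k) < e" using reals_Archimedean by blast
    moreover have "dist (X n) x0 < inverse (Suc k)" if "n \<ge> k" for n
    proof -
      have "dist (X n) x0 < inverse (Suc n)" using X[of n] by simp
      also have "\<dots> \<le> inverse (Suc k)" using that by (simp add: le_imp_inverse_le)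
      finally show ?thesis .
    qed
    ultimately show "\<exists>k. \<forall>n\<ge>k. dist (X n) x0 < e" by (meson less_trans)
  qed
  have min: "f (X n, Y n) \<le> f (X n, y')" for n y' using Y(1)[of n] by (simp add: S_def)
  have "\<forall>n. (X n, Y n) \<in> {(x, y). \<bar>x - x0\<bar> \<le> 1 \<and> f (x, y) \<le> f (x0, 0) + 1}"
  proof
    fix n
    have "dist (X n) x0 < r" "dist (X n) x0 < 1" using X[of n] by auto
    with r(2)[of "X n"] min[of n 0]
    show "(X n, Y n) \<in> {(x, y). \<bar>x - x0\<bar> \<le> 1 \<and> f (x, y) \<le> f (x0, 0) + 1}"
      by (auto simp: dist_real_def)
  qed
  then obtain l s where s: "strict_mono s" "((\<lambda>n. (X n, Y n)) \<circ> s) \<longlonglongrightarrow> l"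
    using compact_imp_seq_compact[OF comp[of x0 "f (x0, 0) + 1"]] unfolding seq_compact_def by meson
  have Xs: "(\<lambda>n. X (s n)) \<longlonglongrightarrow> x0"
    using LIMSEQ_subseq_LIMSEQ[OF Xlim s(1)] by (simp add: o_def)
  have "(\<lambda>n. X (s n)) \<longlonglongrightarrow> fst l" "(\<lambda>n. Y (s n)) \<longlonglongrightarrow> snd l"
    using tendsto_fst[OF s(2)] tendsto_snd[OF s(2)] by (simp_all add: o_def)
  with Xs have l: "l = (x0, snd l)" and Ys: "(\<lambda>n. Y (s n)) \<longlonglongrightarrow> snd l"
    using LIMSEQ_unique by (auto simp: prod_eq_iff)
  have "snd l \<notin> N"
    using Lim_in_closed_set[of "- N" "\<lambda>n. Y (s n)" sequentially "snd l"] Ys Y(2) N(1)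
    by (auto simp: closed_def)
  moreover have "snd l \<in> S f x0"
  proof -
    have "isCont f l" using cont by (simp add: continuous_on_eq_continuous_at del: split_paired_All)
    then have fl: "(\<lambda>n. f (X (s n), Y (s n))) \<longlonglongrightarrow> f (x0, snd l)"
      using isCont_tendsto_compose[OF _ s(2), of f] l by (simp add: o_def)
    have "f (x0, snd l) \<le> f (x0, y')" for y'
      by (rule LIMSEQ_le[OF fl isCont_tendsto_compose[OF contx Xs]]) (use min in auto)
    then show ?thesis by (simp add: S_def)
  qed
  ultimately show False using N(2) by blast
qed

section \<open>One-sided first-order condition\<close>

text \<open>The number \<open>s\<close> encodes the side and the sign of the conclusion together:
  \<open>T s x0\<close> is the open ray to the right of \<open>x0\<close> for \<open>s > 0\<close>
  and to the left for \<open>s < 0\<close>. Taking \<open>s = D\<close> thus covers both signs of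
  \<open>D\<close> in Case II.\<close>

lemma one_sided_first_order:
  fixes F f :: "real \<times> (real ^ 'm::finite) \<Rightarrow> real"
  defines "T \<equiv> \<lambda>s x0. {x::real. 0 < s * (x - x0)}"
  assumes F: "F differentiable (at (x0, y0))" and f: "C_k 2 f"
    and lmin: "local_minimizer_on F (M f) (x0, y0)"
    and inv: "invertible (hess_yy f (x0, y0))"
    and ne: "\<And>x. S f x \<noteq> {}"
    and s: "s \<noteq> 0"
    and S: "\<And>N. open N \<Longrightarrow> y0 \<in> N \<Longrightarrow> \<forall>\<^sub>F x in at x0 within T s x0. S f x \<subseteq> N"
    and w: "0 = grad_y F (x0, y0) + hess_yy f (x0, y0) *v w"
  shows "0 \<le> s * (partial_x F (x0, y0) + hess_yx f (x0, y0) w)"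
proof -
  \<comment> \<open>The value at \<open>x0\<close> is fixed as \<open>y0\<close>, since
    \<open>S f x0\<close> may contain another minimizer.\<close>
  define y where "y x = (if x = x0 then y0 else SOME y. y \<in> S f x)" for x
  have y0: "y x0 = y0" by (simp add: y_def)
  have yS: "y x \<in> S f x" for x
    using lmin ne[of x] by (auto simp: y_def some_in_eq local_minimizer_on_def M_def)
  have lim: "(y \<longlongrightarrow> y x0) (at x0 within T s x0)"
  proof (rule topological_tendstoI)
    fix N assume "open N" "y x0 \<in> N"
    then show "\<forall>\<^sub>F x in at x0 within T s x0. y x \<in> N"
      using S[of N] yS y0 by (auto elim!: eventually_mono)
  qed
  have crit: "grad_y f (x, y x) = 0" for x
    using C_k_Suc_differentiable[of 1 f] f
    by (intro local_minimizer_grad_y_zero S_imp_local_minimizer yS) (simp only: Suc_1)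
  define b where "b = (\<chi> i. partial_x (partial_y i f) (x0, y0))"
  obtain v where v: "transpose (hess_yy f (x0, y0)) *v v = - b"
    using invertible_solve inv transpose_invertible by metis
  have "(y has_derivative (\<lambda>h. h *\<^sub>R v)) (at x0 within T s x0)"
    by (rule critical_curve_has_derivative[OF f _ _ lim])
       (use inv v crit[of x0] crit in \<open>auto simp: y0 b_def\<close>)
  then have "((\<lambda>x. F (x, y x)) has_real_derivative
      partial_x F (x0, y0) + grad_y F (x0, y0) \<bullet> v) (at x0 within T s x0)"
    using has_derivative_along_curve[of F x0 y v "T s x0"] F by (simp add: y0)
  \<comment> \<open>Adjoint identity: with \<open>H = hess_yy f (x0, y0)\<close>, the relations
    \<open>grad_y F (x0, y0) = - (H *v w)\<close> and \<open>transpose H *v v = - b\<close> trade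
    \<open>v\<close> for \<open>w\<close>.\<close>
  moreover have "grad_y F (x0, y0) \<bullet> v = hess_yx f (x0, y0) w"
  proof -
    have "grad_y F (x0, y0) \<bullet> v = - ((hess_yy f (x0, y0) *v w) \<bullet> v)"
      using w by (metis inner_minus_left minus_unique add.commute)
    also have "\<dots> = - ((v v* hess_yy f (x0, y0)) \<bullet> w)"
      by (simp only: dot_lmul_matrix inner_commute[of v])
    also have "\<dots> = b \<bullet> w" using v by simp
    finally show ?thesis by (simp add: b_def hess_yx_def inner_vec_def)
  qed
  ultimately have quot: "((\<lambda>x. s * ((F (x, y x) - F (x0, y0)) / (x - x0))) \<longlongrightarrow>
      s * (partial_x F (x0, y0) + hess_yx f (x0, y0) w)) (at x0 within T s x0)"
    by (intro tendsto_mult_left) (simp add: has_field_derivative_iff y0)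
  \<comment> \<open>The lifted curve stays in \<open>M f\<close> and misses \<open>(x0, y0)\<close>
    because \<open>x \<noteq> x0\<close>, so local minimality on \<open>M f\<close> can be pulled
    back along it.\<close>
  have "filterlim (\<lambda>x. (x, y x)) (at (x0, y0) within M f) (at x0 within T s x0)"
    unfolding filterlim_at
  proof
    show "\<forall>\<^sub>F x in at x0 within T s x0. (x, y x) \<in> M f \<and> (x, y x) \<noteq> (x0, y0)"
      unfolding eventually_at_filter by (rule always_eventually) (use yS in \<open>auto simp: M_def\<close>)
    show "((\<lambda>x. (x, y x)) \<longlongrightarrow> (x0, y0)) (at x0 within T s x0)"
      using lim by (auto intro!: tendsto_intros simp: y0)
  qed
  then have "\<forall>\<^sub>F x in at x0 within T s x0. F (x0, y0) \<le> F (x, y x)"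
    using lmin unfolding local_minimizer_on_def filterlim_iff by blast
  moreover have "\<forall>\<^sub>F x in at x0 within T s x0. 0 < s * (x - x0)"
    by (auto simp: eventually_at_filter T_def)
  \<comment> \<open>The increment of \<open>F\<close> is nonnegative and \<open>x - x0\<close> has
    the sign of \<open>s\<close>. The sign passes to the limit because the one-sided filter is
    nontrivial.\<close>
  ultimately have "\<forall>\<^sub>F x in at x0 within T s x0. 0 \<le> s * ((F (x, y x) - F (x0, y0)) / (x - x0))"
    by eventually_elim (auto simp: zero_le_mult_iff zero_less_mult_iff zero_le_divide_iff mult_le_0_iff)
  moreover have "at x0 within T s x0 \<noteq> bot"
  proof (cases "s > 0")
    case True
    then have "T s x0 = {x0<..}" by (auto simp: T_def zero_less_mult_iff)
    then show ?thesis by simp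
  next
    case False
    then have "T s x0 = {..<x0}" using s by (auto simp: T_def zero_less_mult_iff)
    then show ?thesis by simp
  qed
  ultimately show ?thesis using tendsto_lowerbound[OF quot] by blast
qed

section \<open>Local branches and the gap of their values\<close>

text \<open>A strict minimum over a small closed ball stays interior under perturbation of \<open>x\<close>, so the
  only local minimizer in the fixed ball of the branch is close to \<open>y0\<close>.\<close>

lemma local_min_branch_tendsto:
  fixes f :: "real \<times> (real ^ 'm::finite) \<Rightarrow> real"
  assumes cont: "continuous_on UNIV f"
    and br: "local_min_branch f x0 y0 \<eta>"
    and y0: "y0 \<in> S f x0" and fin: "finite (S f x0)"
  shows "(\<eta> \<longlongrightarrow> y0) (nhds x0)"
proof (rule tendstoI)
  fix e :: real assume "e > 0"
  obtain \<epsilon> where \<epsilon>: "\<epsilon> > 0" and uniq: "\<forall>\<^sub>F x in nhds x0.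
      \<forall>y\<in>ball y0 \<epsilon>. local_minimizer_on (\<lambda>y. f (x, y)) UNIV y \<longleftrightarrow> y = \<eta> x"
    using br by (auto simp: local_min_branch_def eventually_conj_iff)
  obtain r where r: "r > 0" "\<forall>y\<in>S f x0. y \<noteq> y0 \<longrightarrow> r \<le> dist y0 y"
    using finite_set_avoid[OF fin, of y0] by blast
  \<comment> \<open>Below \<open>e\<close> for the claim, below \<open>\<epsilon>\<close> to stay
    where the branch is unique, and below \<open>r\<close> so that the sphere contains no global
    minimizer of \<open>f (x0, \<cdot>)\<close>.\<close>
  define \<delta> where "\<delta> = min (min e \<epsilon>) r / 2"
  have \<delta>: "\<delta> > 0" "\<delta> < e" "\<delta> < \<epsilon>" "\<delta> < r"
    using \<open>e > 0\<close> \<epsilon> r(1) by (auto simp: \<delta>_def min_def)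
  have strict: "f (x0, y0) < f (x0, y)" if "y \<in> sphere y0 \<delta>" for y
  proof (rule ccontr)
    assume "\<not> ?thesis"
    then have "y \<in> S f x0" using y0 by (auto simp: S_def not_less intro: order_trans)
    with r that \<delta> show False by force
  qed
  have "\<forall>\<^sub>F x in nhds x0. \<forall>y\<in>sphere y0 \<delta>. f (x, y0) < f (x, y)"
  proof -
    \<comment> \<open>The strict inequality is an open condition; compactness of the sphere makes it
      hold for all \<open>x\<close> near \<open>x0\<close> at once.\<close>
    define U where "U = {p. f (fst p, y0) < f p}"
    have "open U" unfolding U_def
      by (intro open_Collect_less cont continuous_on_compose2[OF cont] continuous_intros) auto
    moreover have "{x0} \<times> sphere y0 \<delta> \<subseteq> U" using strict by (auto simp: U_def)
    ultimately obtain X where "open X" "x0 \<in> X" "X \<times> sphere y0 \<delta> \<subseteq> U"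
      using Elementary_Topology.tube_lemma[of "sphere y0 \<delta>" U x0] compact_sphere by blast
    then show ?thesis unfolding eventually_nhds U_def by fastforce
  qed
  with uniq show "\<forall>\<^sub>F x in nhds x0. dist (\<eta> x) y0 < e"
  proof eventually_elim
    case (elim x)
    have "continuous_on (cball y0 \<delta>) (\<lambda>y. f (x, y))"
      by (intro continuous_on_compose2[OF cont] continuous_intros) auto
    then obtain y where y: "y \<in> cball y0 \<delta>" "\<forall>u\<in>cball y0 \<delta>. f (x, y) \<le> f (x, u)"
      using continuous_attains_inf[of "cball y0 \<delta>" "\<lambda>y. f (x, y)"] \<delta> by force
    have "y \<notin> sphere y0 \<delta>" using elim(2) y(2) \<delta>(1) by (auto simp: not_less[symmetric] simp del: mem_sphere)
    then have yb: "y \<in> ball y0 \<delta>" using y(1) by auto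
    then have "\<forall>\<^sub>F u in nhds y. u \<in> ball y0 \<delta>" by (intro eventually_nhds_in_open open_ball)
    then have "local_minimizer_on (\<lambda>y. f (x, y)) UNIV y"
      using y(2) unfolding local_minimizer_on_def
      by (auto simp: eventually_at_filter elim!: eventually_mono)
    with elim(1) yb \<delta> have "y = \<eta> x" by auto
    with yb \<delta> show ?case by (auto simp: dist_commute)
  qed
qed

text \<open>Envelope theorem: \<open>grad_y f\<close> vanishes on the branch, so the chain-rule term
  with the velocity of \<open>\<eta>\<close> drops out.\<close>

lemma branch_value_has_derivative:
  fixes f :: "real \<times> (real ^ 'm::finite) \<Rightarrow> real"
  assumes f: "C_k 2 f" and br: "local_min_branch f x0 y0 \<eta>"
    and y0: "y0 \<in> S f x0" and fin: "finite (S f x0)"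
    and inv: "invertible (hess_yy f (x0, y0))"
  shows "((\<lambda>x. f (x, \<eta> x)) has_real_derivative partial_x f (x0, y0)) (at x0)"
proof -
  have diff: "f differentiable (at z)" for z
    using f C_k_Suc_differentiable[of 1 f] by (simp only: Suc_1)
  have cont: "continuous_on UNIV f"
    using f C_k_Suc_continuous[of 1 f] by (simp only: Suc_1)
  have \<eta>0: "\<eta> x0 = y0" using br by (simp add: local_min_branch_def)
  have lim: "(\<eta> \<longlongrightarrow> \<eta> x0) (at x0)"
    using tendsto_mono[OF at_within_le_nhds local_min_branch_tendsto[OF cont br y0 fin]] \<eta>0 by simp
  have "\<forall>\<^sub>F x in nhds x0. local_minimizer_on (\<lambda>y. f (x, y)) UNIV (\<eta> x)"
    using br unfolding local_min_branch_def by (auto elim!: eventually_mono)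
  then have crit: "\<forall>\<^sub>F x in nhds x0. grad_y f (x, \<eta> x) = 0"
    by eventually_elim (rule local_minimizer_grad_y_zero[OF diff])
  then have crit0: "grad_y f (x0, \<eta> x0) = 0" by (rule eventually_nhds_x_imp_x)
  obtain v where v: "transpose (hess_yy f (x0, y0)) *v v = - (\<chi> i. partial_x (partial_y i f) (x0, y0))"
    using invertible_solve inv transpose_invertible by metis
  have "(\<eta> has_derivative (\<lambda>h. h *\<^sub>R v)) (at x0)"
    by (rule critical_curve_has_derivative[OF f _ _ lim _ crit0])
       (use inv v crit in \<open>auto simp: \<eta>0 eventually_at_filter elim!: eventually_mono\<close>)
  from has_derivative_along_curve[OF diff this] show ?thesis
    using crit0 by (simp add: \<eta>0)
qed

text \<open>Upper semicontinuity confines \<open>S f x\<close> to \<open>N\<close> and a ball around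
  \<open>y2\<close>. A minimizer in that ball must be \<open>\<eta>2 x\<close>, which on this side
  is beaten by \<open>\<eta>1 x\<close>.\<close>

lemma case_II_S_one_sided:
  fixes f :: "real \<times> (real ^ 'm::finite) \<Rightarrow> real"
  assumes cont: "continuous_on UNIV f"
    and comp: "\<And>xh c. compact {(x, y). \<bar>x - xh\<bar> \<le> 1 \<and> f (x, y) \<le> c}"
    and S0: "S f x0 = {y1, y2}"
    and \<eta>1: "\<eta>1 x0 = y1" and br2: "local_min_branch f x0 y2 \<eta>2"
    and D: "((\<lambda>x. f (x, \<eta>2 x) - f (x, \<eta>1 x)) has_real_derivative D) (at x0)" "D \<noteq> 0"
    and N: "open N" "y1 \<in> N"
  shows "\<forall>\<^sub>F x in at x0 within {x. 0 < D * (x - x0)}. S f x \<subseteq> N"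
proof -
  let ?g = "\<lambda>x. f (x, \<eta>2 x) - f (x, \<eta>1 x)"
  obtain \<epsilon> where \<epsilon>: "\<epsilon> > 0" and uniq: "\<forall>\<^sub>F x in nhds x0.
      \<forall>y\<in>ball y2 \<epsilon>. local_minimizer_on (\<lambda>y. f (x, y)) UNIV y \<longleftrightarrow> y = \<eta>2 x"
    using br2 by (auto simp: local_min_branch_def eventually_conj_iff)
  have \<eta>2: "\<eta>2 x0 = y2" using br2 by (simp add: local_min_branch_def)
  have "y1 \<in> S f x0" "y2 \<in> S f x0" using S0 by auto
  then have "f (x0, y1) = f (x0, y2)" by (auto simp: S_def intro: antisym)
  then have g0: "?g x0 = 0" by (simp add: \<eta>1 \<eta>2)
  \<comment> \<open>The factor \<open>D\<close> handles both signs: the limit \<open>D * D\<close>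
    is positive, and together with \<open>0 < D * (x - x0)\<close> this makes \<open>?g x\<close>
    positive.\<close>
  have "((\<lambda>x. D * (?g x / (x - x0))) \<longlongrightarrow> D * D) (at x0)"
    using D(1) g0 by (intro tendsto_mult_left) (simp add: has_field_derivative_iff)
  then have "\<forall>\<^sub>F x in at x0. 0 < D * (?g x / (x - x0))"
    using D(2) by (intro order_tendstoD(1)[of _ "D * D"]) (auto simp: not_sum_power2_lt_zero zero_less_mult_iff)
  then have pos: "\<forall>\<^sub>F x in at x0 within {x. 0 < D * (x - x0)}. 0 < D * (?g x / (x - x0))"
    by (auto simp: eventually_at_filter elim!: eventually_mono)
  have "\<forall>\<^sub>F x in nhds x0. S f x \<subseteq> N \<union> ball y2 \<epsilon>"
    using N \<epsilon> S0 by (intro S_upper_semicontinuous[OF cont comp]) auto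
  with uniq have "\<forall>\<^sub>F x in nhds x0. (\<forall>y\<in>ball y2 \<epsilon>.
      local_minimizer_on (\<lambda>y. f (x, y)) UNIV y \<longleftrightarrow> y = \<eta>2 x) \<and> S f x \<subseteq> N \<union> ball y2 \<epsilon>"
    by (rule eventually_conj)
  then have near: "\<forall>\<^sub>F x in at x0 within {x. 0 < D * (x - x0)}. (\<forall>y\<in>ball y2 \<epsilon>.
      local_minimizer_on (\<lambda>y. f (x, y)) UNIV y \<longleftrightarrow> y = \<eta>2 x) \<and> S f x \<subseteq> N \<union> ball y2 \<epsilon>"
    by (auto simp: eventually_at_filter elim!: eventually_mono)
  have "\<forall>\<^sub>F x in at x0 within {x. 0 < D * (x - x0)}. 0 < D * (x - x0)"
    by (auto simp: eventually_at_filter)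
  with near pos show ?thesis
  proof eventually_elim
    case (elim x)
    have g: "0 < ?g x"
      using elim(2,3) by (auto simp: zero_less_mult_iff zero_less_divide_iff mult_less_0_iff)
    show ?case
    proof
      fix y assume y: "y \<in> S f x"
      show "y \<in> N"
      proof (rule ccontr)
        assume "y \<notin> N"
        then have "y = \<eta>2 x" using elim(1) y S_imp_local_minimizer[OF y] by blast
        moreover have "f (x, y) \<le> f (x, \<eta>1 x)" using y by (simp add: S_def)
        ultimately show False using g by simp
      qed
    qed
  qed
qed

section \<open>Multipliers in the two cases\<close>

theorem corollary6p5:
  fixes F f :: "real \<times> (real ^ 'm::finite) \<Rightarrow> real"
    and xb :: real and yb :: "real ^ 'm"
  assumes "C_k 1 F"
    and "C_k 3 f"
    and "\<And>xh c. compact {(x, y). \<bar>x - xh\<bar> \<le> 1 \<and> f (x, y) \<le> c}"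
    and "local_minimizer_on F (M f) (xb, yb)"
    and "simple_at f xb yb"
  shows "\<exists>\<mu> w. \<mu> \<ge> 0 \<and>
     (case_I f xb yb \<longrightarrow> \<mu> = 0 \<and>
        0 = partial_x F (xb, yb) + hess_yx f (xb, yb) w) \<and>
     (\<forall>yb2. case_II f xb yb yb2 \<longrightarrow>
        0 = partial_x F (xb, yb) + \<mu> * (partial_x f (xb, yb) - partial_x f (xb, yb2))
            + hess_yx f (xb, yb) w) \<and>
     0 = grad_y F (xb, yb) + hess_yy f (xb, yb) *v w"
proof -
  have F: "F differentiable (at (xb, yb))" using assms(1) by simp
  have f: "C_k 2 f"
    using assms(2) C_k_Suc_imp_C_k[of 2 f] by (simp only: eval_nat_numeral)
  have cont: "continuous_on UNIV f"
    using C_k_Suc_continuous[of 2 f] assms(2) by (simp add: eval_nat_numeral)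
  note comp = assms(3) and lmin = assms(4)
  have inv: "invertible (hess_yy f (xb, yb))"
    using assms(5) by (auto simp: simple_at_def case_I_def case_II_def type_1_def)
  then obtain w where "hess_yy f (xb, yb) *v w = - grad_y F (xb, yb)"
    by (rule invertible_solve)
  then have w: "0 = grad_y F (xb, yb) + hess_yy f (xb, yb) *v w" by simp
  define A where "A = partial_x F (xb, yb) + hess_yx f (xb, yb) w"
  \<comment> \<open>Used with \<open>s = 1\<close> and \<open>s = - 1\<close> in Case I and with
    \<open>s = D\<close> in Case II.\<close>
  have sign: "0 \<le> s * A"
    if "s \<noteq> 0" "\<And>N. open N \<Longrightarrow> yb \<in> N \<Longrightarrow> \<forall>\<^sub>F x in at xb within {x. 0 < s * (x - xb)}. S f x \<subseteq> N" for s
    unfolding A_def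
    by (rule one_sided_first_order[OF F f lmin inv S_nonempty[OF cont comp] that w])
  from assms(5) consider "case_I f xb yb" | yb2 where "case_II f xb yb yb2"
    by (auto simp: simple_at_def)
  then show ?thesis
  proof cases
    case 1
    then have S0: "S f xb = {yb}" by (simp add: case_I_def)
    have "\<forall>\<^sub>F x in at xb within T. S f x \<subseteq> N" if "open N" "yb \<in> N" for N T
      using S_upper_semicontinuous[OF cont comp that(1), of xb] that S0
      by (auto simp: eventually_at_filter elim!: eventually_mono)
    with sign[of 1] sign[of "- 1"] have "A = 0" by simp
    moreover have "\<not> case_II f xb yb yb2" for yb2
      using S0 by (auto simp: case_II_def)
    ultimately show ?thesis using w by (intro exI[of _ 0] exI[of _ w]) (simp add: A_def)
  next
    case 2
    then have S0: "S f xb = {yb, yb2}" and "yb \<noteq> yb2" and inv2: "invertible (hess_yy f (xb, yb2))"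
      by (auto simp: case_II_def)
    obtain \<eta>1 \<eta>2 D where br: "local_min_branch f xb yb \<eta>1" "local_min_branch f xb yb2 \<eta>2"
      and D: "((\<lambda>x. f (x, \<eta>2 x) - f (x, \<eta>1 x)) has_real_derivative D) (at xb)" "D \<noteq> 0"
      using 2 by (auto simp: case_II_def)
    \<comment> \<open>Case II only asserts that the gap has some nonzero derivative
      \<open>D\<close>; the envelope formula and uniqueness of derivatives identify it.\<close>
    have "((\<lambda>x. f (x, \<eta>2 x) - f (x, \<eta>1 x)) has_real_derivative
        partial_x f (xb, yb2) - partial_x f (xb, yb)) (at xb)"
      using S0 inv inv2 by (intro DERIV_diff branch_value_has_derivative[OF f] br) auto
    with D(1) have D_eq: "D = partial_x f (xb, yb2) - partial_x f (xb, yb)"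
      by (rule DERIV_unique)
    have "\<eta>1 xb = yb" using br(1) by (simp add: local_min_branch_def)
    then have "0 \<le> D * A"
      by (intro sign D(2) case_II_S_one_sided[OF cont comp S0 _ br(2) D])
    then have "0 \<le> A / D" by (auto simp: zero_le_mult_iff zero_le_divide_iff)
    moreover have "\<not> case_I f xb yb" using S0 \<open>yb \<noteq> yb2\<close> by (auto simp: case_I_def)
    \<comment> \<open>The conclusion ranges over all \<open>yb2\<close>, so the second minimizer
      must be determined by \<open>S f xb\<close>.\<close>
    moreover have "yb2' = yb2" if "case_II f xb yb yb2'" for yb2'
      using that S0 \<open>yb \<noteq> yb2\<close> by (auto simp: case_II_def doubleton_eq_iff)
    \<comment> \<open>The difference multiplied by \<open>\<mu>\<close> equals \<open>- D\<close>,
      which forces \<open>\<mu> = A / D\<close>.\<close>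
    moreover have "0 = A + (A / D) * (partial_x f (xb, yb) - partial_x f (xb, yb2))"
    proof -
      have "partial_x f (xb, yb) - partial_x f (xb, yb2) = - D" using D_eq by simp
      then show ?thesis using D(2) by simp
    qed
    ultimately show ?thesis using w
      by (intro exI[of _ "A / D"] exI[of _ w]) (auto simp: A_def algebra_simps)
  qed
qed

end
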